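(* Let $D$ be the derivation on $\mathbb{Z}[w,x,y,z]$ determined by $D(w)=wy$, $D(x)=yz$, $D(y)=xz$, $D(z)=xy$. Then for every $n\ge0$, $$D^n(w)=w\sum_{T\in\mathcal{T}_n}x^{\mathsf{ee}^*(T)}y^{\mathsf{oe}^*(T)}z^{\mathsf{odd}^*(T)}.$$
   Context: A derivation $D$ is additive and satisfies $D(uv)=D(u)v+uD(v)$. $\mathcal{T}_n$ is the set of increasing trees on $\{1,\dots,n\}$: plane trees (rooted trees with linearly ordered children) with $n+1$ nodes labeled bijectively by $0,1,\dots,n$ such that labels increase along every root-to-leaf path and the labels of the children of each node increase from left to right. The degree of a node is its number of children; its level is its distance from the root (root at level $0$). $\mathsf{odd}^*(T)$ is the number of odd-degree nodes other than the root; $\mathsf{oe}^*(T)$ (resp. $\mathsf{ee}^*(T)$) is the number of even-degree nodes other than the root on odd (resp. even) levels. *)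

theory Defs
  imports "HOL-Library.Poly_Mapping"
begin

section \<open>The ring \<open>\<int>[w,x,y,z]\<close> and derivations\<close>

datatype indet = W | X | Y | Z

text \<open>A monomial is a finitely supported exponent function, a polynomial is a finitely supported
  integer coefficient function on monomials; multiplication is convolution.\<close>

type_synonym zpoly = "(indet \<Rightarrow>\<^sub>0 nat) \<Rightarrow>\<^sub>0 int"

definition var :: "indet \<Rightarrow> zpoly" where
  "var v = Poly_Mapping.single (Poly_Mapping.single v 1) 1"

definition derivation :: "('a::ring \<Rightarrow> 'a) \<Rightarrow> bool" where
  "derivation D \<longleftrightarrow>
     (\<forall>u v. D (u + v) = D u + D v) \<and> (\<forall>u v. D (u * v) = D u * v + u * D v)"


section \<open>Increasing trees\<close>

datatype ptree = Node (label: nat) (children: "ptree list")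

definition degree :: "ptree \<Rightarrow> nat" where
  "degree t = length (children t)"

text \<open>The nodes of \<open>t\<close> in preorder; a node is given by its level and the subtree hanging from it,
  where \<open>k\<close> is the level assigned to the root of \<open>t\<close>.\<close>

fun nodes_from :: "nat \<Rightarrow> ptree \<Rightarrow> (nat \<times> ptree) list" where
  "nodes_from k (Node a ts) = (k, Node a ts) # concat (map (nodes_from (Suc k)) ts)"

abbreviation nodes :: "ptree \<Rightarrow> (nat \<times> ptree) list" where
  "nodes t \<equiv> nodes_from 0 t"

definition labels :: "ptree \<Rightarrow> nat list" where
  "labels t = map (\<lambda>(k, s). label s) (nodes t)"

definition increasing_trees :: "nat \<Rightarrow> ptree set" where
  "increasing_trees n =
     {t. distinct (labels t) \<and> set (labels t) = {0..n} \<and>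
         (\<forall>(k, s) \<in> set (nodes t).
            (\<forall>c \<in> set (children s). label s < label c) \<and>
            sorted_wrt (<) (map label (children s)))}"

text \<open>The root is the only node on level 0, so \<open>k \<noteq> 0\<close> singles out the other nodes.\<close>

definition odd_star :: "ptree \<Rightarrow> nat" where
  "odd_star t = length (filter (\<lambda>(k, s). k \<noteq> 0 \<and> odd (degree s)) (nodes t))"

definition oe_star :: "ptree \<Rightarrow> nat" where
  "oe_star t = length (filter (\<lambda>(k, s). k \<noteq> 0 \<and> odd k \<and> even (degree s)) (nodes t))"

definition ee_star :: "ptree \<Rightarrow> nat" where
  "ee_star t = length (filter (\<lambda>(k, s). k \<noteq> 0 \<and> even k \<and> even (degree s)) (nodes t))"


section \<open>Well-definedness\<close>

text \<open>The sum over increasing trees is a finite one, and a derivation of \<open>\<int>[w,x,y,z]\<close> exists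
  and is unique for any prescribed values on the indeterminates.\<close>

lemma length_nodes_from: "length (nodes_from k t) = length (nodes_from j t)"
proof (induction t arbitrary: k j)
  case (Node a ts)
  then have "map (length \<circ> nodes_from (Suc k)) ts = map (length \<circ> nodes_from (Suc j)) ts"
    by simp
  then show ?case by (simp only: nodes_from.simps length_Cons length_concat map_map)
qed

lemma label_nodes_from:
  "(\<lambda>(k, s). label s) ` set (nodes_from k t) = (\<lambda>(k, s). label s) ` set (nodes_from j t)"
proof (induction t arbitrary: k j)
  case (Node a ts)
  have "(\<Union>x\<in>set ts. (\<lambda>(k, s). label s) ` set (nodes_from (Suc k) x)) =
        (\<Union>x\<in>set ts. (\<lambda>(k, s). label s) ` set (nodes_from (Suc j) x))"
    using Node by (intro SUP_cong) auto
  then show ?case by (simp add: image_UN)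
qed

lemma finite_trees_le: "finite {t. set (labels t) \<subseteq> {0..n} \<and> length (labels t) \<le> m}"
proof (induction m)
  case 0
  have "labels t \<noteq> []" for t by (cases t) (simp add: labels_def)
  then show ?case by simp
next
  case (Suc m)
  let ?S = "{t. set (labels t) \<subseteq> {0..n} \<and> length (labels t) \<le> m}"
  have "{t. set (labels t) \<subseteq> {0..n} \<and> length (labels t) \<le> Suc m} \<subseteq>
        (\<lambda>(a, ts). Node a ts) ` ({0..n} \<times> {ts. set ts \<subseteq> ?S \<and> length ts \<le> m})"
  proof (safe, goal_cases)
    case (1 t)
    obtain a ts where t: "t = Node a ts" by (cases t)
    have len: "(\<Sum>s\<leftarrow>ts. length (nodes_from (Suc 0) s)) \<le> m"
      using 1 by (simp add: labels_def t length_concat comp_def)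
    have pos: "length (nodes_from (Suc 0) s) \<ge> 1" for s by (cases s) simp
    have "length ts = (\<Sum>s\<leftarrow>ts. 1)" by (simp add: sum_list_triv)
    also have "\<dots> \<le> (\<Sum>s\<leftarrow>ts. length (nodes_from (Suc 0) s))"
      by (intro sum_list_mono pos)
    finally have "length ts \<le> m" using len by simp
    moreover have "s \<in> ?S" if s: "s \<in> set ts" for s
    proof -
      have "length (nodes_from (Suc 0) s) \<le> m"
        using member_le_sum_list[of "length (nodes_from (Suc 0) s)"
            "map (\<lambda>s. length (nodes_from (Suc 0) s)) ts"] s len
        by simp
      then have "length (labels s) \<le> m"
        by (simp add: labels_def length_nodes_from[of 0 s "Suc 0"])
      moreover have "set (labels s) = (\<lambda>(k, s). label s) ` set (nodes_from (Suc 0) s)"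
        by (simp add: labels_def label_nodes_from[of 0 s "Suc 0"])
      then have "set (labels s) \<subseteq> set (labels t)"
        using s by (auto simp: labels_def t)
      ultimately show ?thesis using 1 by blast
    qed
    moreover have "a \<in> {0..n}" using 1 by (auto simp: labels_def t)
    ultimately show ?case unfolding t by (intro image_eqI[of _ _ "(a, ts)"]) auto
  qed
  moreover have "finite ({0..n} \<times> {ts. set ts \<subseteq> ?S \<and> length ts \<le> m})"
    using Suc by (intro finite_cartesian_product finite_lists_length_le) auto
  ultimately show ?case by (meson finite_imageI finite_subset)
qed

lemma finite_increasing_trees: "finite (increasing_trees n)"
proof (rule finite_subset)
  show "increasing_trees n \<subseteq> {t. set (labels t) \<subseteq> {0..n} \<and> length (labels t) \<le> Suc n}"
    by (auto simp: increasing_trees_def simp flip: distinct_card)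
qed (rule finite_trees_le)

lemma UNIV_indet: "UNIV = {W, X, Y, Z}"
  using indet.exhaust by blast

lemma finite_UNIV_indet: "finite (UNIV :: indet set)"
  by (simp add: UNIV_indet)

lemma derivation_exists: "\<exists>D. derivation D \<and> (\<forall>v. D (var v) = g v)"
proof -
  define e :: "indet \<Rightarrow> (indet \<Rightarrow>\<^sub>0 nat)" where "e v = Poly_Mapping.single v 1" for v
  define d :: "(indet \<Rightarrow>\<^sub>0 nat) \<Rightarrow> zpoly"
    where "d m = (\<Sum>v\<in>UNIV. of_nat (Poly_Mapping.lookup m v) * (frag_of (m - e v) * g v))" for m
  define D where "D = frag_extend d"
  have fm: "frag_of (a + b) = frag_of a * frag_of b" for a b :: "indet \<Rightarrow>\<^sub>0 nat"
    by (simp add: mult_single)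
  have shift: "of_nat (Poly_Mapping.lookup a v) * (frag_of (a + b - e v) * g v) =
      of_nat (Poly_Mapping.lookup a v) * (frag_of (a - e v) * g v) * frag_of b" for a b v
  proof (cases "Poly_Mapping.lookup a v = 0")
    case False
    have "a + b - e v = (a - e v) + b"
      by (rule poly_mapping_eqI) (use False in \<open>auto simp: lookup_add lookup_minus e_def lookup_single when_def\<close>)
    then show ?thesis by (simp only: fm) (simp add: algebra_simps)
  qed simp
  have d_add: "d (a + b) = d a * frag_of b + frag_of a * d b" for a b
  proof -
    have "d (a + b) = (\<Sum>v\<in>UNIV. of_nat (Poly_Mapping.lookup a v) * (frag_of (a + b - e v) * g v)
        + of_nat (Poly_Mapping.lookup b v) * (frag_of (b + a - e v) * g v))"
      by (simp add: d_def lookup_add algebra_simps)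
    also have "\<dots> = (\<Sum>v\<in>UNIV. of_nat (Poly_Mapping.lookup a v) * (frag_of (a - e v) * g v)) * frag_of b
        + (\<Sum>v\<in>UNIV. of_nat (Poly_Mapping.lookup b v) * (frag_of (b - e v) * g v)) * frag_of a"
      by (simp only: shift sum.distrib sum_distrib_right)
    finally show ?thesis by (simp add: d_def mult.commute)
  qed
  have D_of: "D (frag_of m * frag_of m') = D (frag_of m) * frag_of m' + frag_of m * D (frag_of m')"
    for m m' by (simp only: D_def flip: fm) (simp add: d_add)
  have D_one: "D (frag_of m * q) = D (frag_of m) * q + frag_of m * D q" for m q
    using subset_UNIV[of "Poly_Mapping.keys q"]
  proof (induction q rule: frag_induction)
    case zero then show ?case by (simp add: D_def)
  next
    case (one x) show ?case by (rule D_of)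
  next
    case (diff a b) then show ?case by (simp add: right_diff_distrib D_def frag_extend_diff)
  qed
  have "D (p * q) = D p * q + p * D q" for p q
    using subset_UNIV[of "Poly_Mapping.keys p"]
  proof (induction p rule: frag_induction)
    case zero then show ?case by (simp add: D_def)
  next
    case (one x) show ?case by (rule D_one)
  next
    case (diff a b) then show ?case by (simp add: left_diff_distrib D_def frag_extend_diff)
  qed
  then have "derivation D" by (simp add: derivation_def D_def frag_extend_add)
  moreover have "D (var v) = g v" for v
  proof -
    have "D (var v) = (\<Sum>u\<in>UNIV. of_nat (Poly_Mapping.lookup (e v) u) * (frag_of (e v - e u) * g u))"
      by (simp add: D_def var_def d_def e_def)
    also have "\<dots> = (\<Sum>u\<in>UNIV. if u = v then g v else 0)"
      by (intro sum.cong) (auto simp: e_def lookup_single when_def)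
    finally show ?thesis by (simp add: finite_UNIV_indet)
  qed
  ultimately show ?thesis by blast
qed

lemma derivation_unique:
  assumes "derivation D" "derivation E" "\<And>v. D (var v) = E (var v)"
  shows "D = (E :: zpoly \<Rightarrow> zpoly)"
proof -
  have add: "D (u + v) = D u + D v" "E (u + v) = E u + E v"
    and mult: "D (u * v) = D u * v + u * D v" "E (u * v) = E u * v + u * E v" for u v
    using assms by (auto simp: derivation_def)
  have zero: "D 0 = 0" "E 0 = 0" using add[of 0 0] by simp_all
  have diff: "D (u - v) = D u - D v" "E (u - v) = E u - E v" for u v
    using add[of "u - v" v] by simp_all
  have one: "D 1 = 0" "E 1 = 0" using mult[of 1 1] by simp_all
  have mono: "D (frag_of m) = E (frag_of m)" for m
  proof (induction "\<Sum>v\<in>UNIV. Poly_Mapping.lookup m v" arbitrary: m)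
    case 0
    then have "m = 0"
      by (intro poly_mapping_eqI) (simp add: finite_UNIV_indet)
    then show ?case using one by simp
  next
    case (Suc k)
    then obtain v where v: "Poly_Mapping.lookup m v \<noteq> 0"
      by (metis (no_types, lifting) nat.distinct(1) sum.neutral)
    define m' where "m' = m - Poly_Mapping.single v 1"
    have m: "m = m' + Poly_Mapping.single v 1"
      by (rule poly_mapping_eqI)
        (use v in \<open>auto simp: m'_def lookup_add lookup_minus lookup_single when_def\<close>)
    have "(\<Sum>u\<in>UNIV. Poly_Mapping.lookup m u) = (\<Sum>u\<in>UNIV. Poly_Mapping.lookup m' u) + (\<Sum>u\<in>UNIV. if u = v then 1 else 0)"
      unfolding m by (simp add: lookup_add lookup_single when_def sum.distrib finite_UNIV_indet)
    then have "k = (\<Sum>u\<in>UNIV. Poly_Mapping.lookup m' u)"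
      using Suc.hyps(2) by (simp add: finite_UNIV_indet)
    then have "D (frag_of m') = E (frag_of m')" by (rule Suc.hyps(1))
    moreover have "frag_of m = frag_of m' * var v" by (simp add: m var_def mult_single)
    ultimately show ?case by (simp add: mult assms(3))
  qed
  have "D p = E p" for p
    using subset_UNIV[of "Poly_Mapping.keys p"]
    by (induction p rule: frag_induction) (auto simp: zero mono diff)
  then show ?thesis by blast
qed

end

theory Submission
  imports Defs "HOL-Library.Multiset"
begin

text \<open>Every increasing tree on \<open>{1..n+1}\<close> arises from exactly one increasing tree on \<open>{1..n}\<close> by
  attaching the leaf \<open>n+1\<close> as the last child of one of the \<open>n+1\<close> nodes. Give the root the weight
  \<open>w\<close>, every other node of odd degree the weight \<open>z\<close>, and a node of even degree the weight \<open>y\<close> or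
  \<open>x\<close> according to the parity of its level. Attaching a leaf to a node of weight \<open>u\<close> replaces the
  factor \<open>u\<close> by \<open>D u\<close> in the weight of the tree, so by the Leibniz rule the sum over all ways of
  attaching \<open>n+1\<close> is the derivative of the weight of the tree.\<close>

section \<open>Labels and the increasing condition\<close>

text \<open>Labels do not depend on the starting level, so \<open>labels\<close> recurses over
  subtrees even though \<open>nodes_from\<close> shifts the level at each step.\<close>

lemma map_label_nodes_from:
  "map (\<lambda>(k, s). label s) (nodes_from k t) = map (\<lambda>(k, s). label s) (nodes_from j t)"
proof (induction t arbitrary: k j)
  case (Node a ts)
  then have "map (\<lambda>t. map (\<lambda>(k, s). label s) (nodes_from (Suc k) t)) ts =
      map (\<lambda>t. map (\<lambda>(k, s). label s) (nodes_from (Suc j) t)) ts"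
    by (intro map_cong[OF refl])
  then show ?case by (simp add: map_concat comp_def del: map_eq_conv)
qed

lemma labels_Node [simp]: "labels (Node a ts) = a # concat (map labels ts)"
  by (simp add: labels_def[abs_def] map_concat comp_def map_label_nodes_from[of "Suc 0" _ 0])

lemma level_nodes_from: "(j, s) \<in> set (nodes_from k t) \<Longrightarrow> k \<le> j"
  by (induction t arbitrary: k) (auto dest: Suc_leD)

lemma label_in_labels [simp]: "label t \<in> set (labels t)"
  by (cases t) simp

text \<open>Recursive form of the order condition in \<open>increasing_trees\<close>, suited to
  structural induction.\<close>

fun increasing :: "ptree \<Rightarrow> bool" where
  "increasing (Node a ts) \<longleftrightarrow>
     (\<forall>c\<in>set ts. a < label c \<and> increasing c) \<and> sorted_wrt (<) (map label ts)"

lemma increasing_iff_nodes_from: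
  "increasing t \<longleftrightarrow>
     (\<forall>(k, s) \<in> set (nodes_from k t).
        (\<forall>c \<in> set (children s). label s < label c) \<and>
        sorted_wrt (<) (map label (children s)))"
proof (induction t arbitrary: k)
  case (Node a ts)
  then have "(\<forall>c\<in>set ts. increasing c) \<longleftrightarrow>
      (\<forall>c\<in>set ts. \<forall>(k, s) \<in> set (nodes_from (Suc k) c).
        (\<forall>c \<in> set (children s). label s < label c) \<and>
        sorted_wrt (<) (map label (children s)))"
    by (intro ball_cong refl)
  then show ?case by (simp add: ball_UN) blast
qed

lemma increasing_trees_iff:
  "t \<in> increasing_trees n \<longleftrightarrow> distinct (labels t) \<and> set (labels t) = {0..n} \<and> increasing t"
  by (simp add: increasing_trees_def increasing_iff_nodes_from[of t 0])

lemma increasing_label_le: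
  assumes "increasing t" "l \<in> set (labels t)"
  shows "label t \<le> l"
  using assms
proof (induction t arbitrary: l)
  case (Node a ts)
  then show ?case by (fastforce intro: less_imp_le less_le_trans)
qed

lemma label_increasing_trees:
  assumes "t \<in> increasing_trees n"
  shows "label t = 0"
  using assms increasing_label_le[of t 0] by (auto simp: increasing_trees_iff)

lemma increasing_trees_0: "increasing_trees 0 = {Node 0 []}"
proof -
  have "t = Node 0 []" if t: "t \<in> increasing_trees 0" for t
  proof (cases t)
    case (Node a ts)
    have "c \<notin> set ts" for c
    proof
      assume c: "c \<in> set ts"
      then have "label c \<in> set (labels t)" unfolding Node by force
      then show False using t c by (auto simp: increasing_trees_iff Node)
    qed
    then have "ts = []" by (meson last_in_set)
    then show ?thesis using label_increasing_trees[OF t] by (simp add: Node)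
  qed
  then show ?thesis by (auto simp: increasing_trees_iff)
qed


section \<open>Attaching a leaf\<close>

text \<open>The leaf \<open>m\<close> is attached below \<^emph>\<open>every\<close> node with label \<open>p\<close>; there is at most one such node
  when the labels are distinct.\<close>

fun graft :: "nat \<Rightarrow> nat \<Rightarrow> ptree \<Rightarrow> ptree" where
  "graft p m (Node a ts) = Node a (map (graft p m) ts @ (if a = p then [Node m []] else []))"

text \<open>Left inverse of grafting a fresh leaf \<open>m\<close>. Whole subtrees below a child
  \<open>m\<close> are dropped, which for a leaf removes just that leaf.\<close>

fun prune :: "nat \<Rightarrow> ptree \<Rightarrow> ptree" where
  "prune m (Node a ts) = Node a (map (prune m) (filter (\<lambda>c. label c \<noteq> m) ts))"

text \<open>Recovers the point of attachment. It is set-valued so that the recursion is a plain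
  union, however often \<open>m\<close> occurs.\<close>

fun parents :: "nat \<Rightarrow> ptree \<Rightarrow> nat set" where
  "parents m (Node a ts) =
     (if m \<in> label ` set ts then {a} else {}) \<union> (\<Union>c\<in>set ts. parents m c)"

section \<open>Effect of the attachment on labels and order\<close>

lemma label_graft [simp]: "label (graft p m t) = label t"
  by (cases t) simp

lemma graft_eq_self: "p \<notin> set (labels t) \<Longrightarrow> graft p m t = t"
  by (induction t) (auto intro!: map_idI)

lemma map_graft_eq_self:
  "p \<notin> set (concat (map labels ts)) \<Longrightarrow> map (graft p m) ts = ts"
  by (auto intro!: map_idI graft_eq_self)

text \<open>Each node labelled \<open>p\<close> receives one leaf. Counting with multiplicity allows
  distinctness to be transferred from a graft back to the original tree.\<close>

lemma mset_labels_graft: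
  "mset (labels (graft p m t)) =
     mset (labels t) + replicate_mset (count (mset (labels t)) p) m"
proof (induction t)
  case (Node a ts)
  then have "mset (concat (map labels (map (graft p m) ts))) =
      mset (concat (map labels ts)) +
      replicate_mset (count (mset (concat (map labels ts))) p) m"
    by (induction ts) (simp_all add: multiset_eq_iff)
  then show ?case by (simp add: comp_def)
qed

text \<open>\<open>m\<close> is appended after all other children and exceeds every label, so both
  order conditions survive.\<close>

lemma increasing_graft:
  assumes "increasing t" "\<forall>l\<in>set (labels t). l < m"
  shows "increasing (graft p m t)"
  using assms
proof (induction t)
  case (Node a ts)
  have lt: "label c < m" if "c \<in> set ts" for c
    using Node.prems(2) that label_in_labels[of c] by auto
  have "\<forall>c\<in>set ts. increasing (graft p m c)" using Node by auto
  then show ?case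
    using Node.prems lt by (auto simp: comp_def sorted_wrt_append)
qed

section \<open>Inverting the attachment\<close>

lemma prune_graft: "m \<notin> set (labels t) \<Longrightarrow> prune m (graft p m t) = t"
proof (induction t)
  case (Node a ts)
  have "label c \<noteq> m" if "c \<in> set ts" for c
    using Node.prems that label_in_labels[of c] by auto
  then have "filter (\<lambda>c. label c \<noteq> m) (map (graft p m) ts) = map (graft p m) ts"
    by (auto simp: filter_id_conv)
  then show ?case using Node by (auto intro!: map_idI)
qed

lemma parents_graft:
  "m \<notin> set (labels t) \<Longrightarrow> parents m (graft p m t) = set (labels t) \<inter> {p}"
proof (induction t)
  case (Node a ts)
  have "label c \<noteq> m" if "c \<in> set ts" for c
    using Node.prems that label_in_labels[of c] by auto
  moreover have "(\<Union>c\<in>set ts. parents m (graft p m c)) = (\<Union>c\<in>set ts. set (labels c) \<inter> {p})"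
    using Node by (intro SUP_cong) auto
  moreover from calculation(1) have "m \<notin> label ` graft p m ` set ts"
    by (metis (no_types, lifting) imageE label_graft)
  ultimately show ?case by auto
qed

text \<open>The largest label \<open>m\<close> sits on a leaf that is the last child of its parent,
  since children and right siblings of that node would have larger labels. Removing this leaf gives
  \<open>s\<close>, and \<open>p\<close> is the label of its parent.\<close>

lemma increasing_eq_graft:
  assumes "increasing t" "distinct (labels t)" "\<forall>l\<in>set (labels t). l \<le> m"
    and "label t \<noteq> m" "m \<in> set (labels t)"
  obtains p s where "t = graft p m s" "p \<in> set (labels s)" "m \<notin> set (labels s)" "increasing s"
  using assms
proof (induction t arbitrary: thesis)
  case (Node a ts)
  obtain c where "c \<in> set ts" and mc: "m \<in> set (labels c)"
    using Node.prems by auto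
  then obtain us vs where ts: "ts = us @ c # vs" by (meson split_list)
  have dist: "distinct (labels c)"
    and a: "a \<notin> set (concat (map labels ts))"
    and us: "set (concat (map labels us)) \<inter> set (labels c) = {}"
    and vs: "set (concat (map labels vs)) \<inter> set (labels c) = {}"
    using Node.prems(3) by (auto simp: ts)
  have inc: "increasing c" using Node.prems(2) by (simp add: ts)
  show ?case
  proof (cases "label c = m")
    case True
    \<comment> \<open>Right siblings of \<open>c\<close>, and below also its children, would exceed
      the maximum \<open>m\<close>.\<close>
    have "b \<notin> set vs" for b
    proof
      assume b: "b \<in> set vs"
      then have "m < label b" using Node.prems(2) True by (auto simp: ts sorted_wrt_append)
      moreover have "label b \<le> m"
        using Node.prems(4) b by (force simp: ts)
      ultimately show False by simp
    qed
    then have "vs = []" by (meson last_in_set)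
    obtain cs where cs: "c = Node m cs" using True by (cases c) auto
    have "b \<notin> set cs" for b
    proof
      assume b: "b \<in> set cs"
      then have "m < label b" using inc by (auto simp: cs)
      moreover have "label b \<le> m"
        using Node.prems(4) b by (force simp: ts cs)
      ultimately show False by simp
    qed
    then have "cs = []" by (meson last_in_set)
    then have "c = Node m []" by (simp add: cs)
    show ?thesis
    proof (rule Node.prems(1)[of a "Node a us"])
      have "map (graft a m) us = us" using a by (intro map_graft_eq_self) (simp add: ts)
      then show "Node a ts = graft a m (Node a us)"
        by (simp add: ts \<open>vs = []\<close> \<open>c = Node m []\<close>)
      show "m \<notin> set (labels (Node a us))" using us mc Node.prems(5) by auto
      show "increasing (Node a us)"
        using Node.prems(2) by (simp add: ts sorted_wrt_append)
    qed simp
  next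
    case False
    have "\<forall>l\<in>set (labels c). l \<le> m" using Node.prems(4) by (auto simp: ts)
    then obtain p s where s: "c = graft p m s" "p \<in> set (labels s)" "m \<notin> set (labels s)" "increasing s"
      using Node.IH[OF \<open>c \<in> set ts\<close> _ inc dist _ False mc] by blast
    \<comment> \<open>Grafting only adds labels, so \<open>p\<close> occurs in \<open>c\<close>.
      Distinctness then keeps \<open>p\<close> away from \<open>a\<close>, \<open>us\<close> and
      \<open>vs\<close>, and grafting the whole tree changes \<open>s\<close> only.\<close>
    have pc: "p \<in> set (labels c)"
      using s(2) mset_labels_graft[of p m s] unfolding s(1)
      by (metis set_mset_mset union_iff)
    show ?thesis
    proof (rule Node.prems(1)[of p "Node a (us @ s # vs)"])
      have "map (graft p m) us = us" "map (graft p m) vs = vs"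
        using us vs pc by (blast intro: map_graft_eq_self)+
      moreover have "a \<noteq> p" using a pc by (auto simp: ts)
      ultimately show "Node a ts = graft p m (Node a (us @ s # vs))"
        using s(1) by (simp add: ts)
      show "p \<in> set (labels (Node a (us @ s # vs)))" using s(2) by simp
      show "m \<notin> set (labels (Node a (us @ s # vs)))"
        using us vs mc s(3) Node.prems(5) by auto
      have "label c = label s" using s(1) by simp
      then show "increasing (Node a (us @ s # vs))"
        using Node.prems(2) s(4) by (simp add: ts)
    qed
  qed
qed

section \<open>The bijection between trees with a marked node and larger trees\<close>

lemma mset_labels_graft_distinct:
  assumes "distinct (labels t)" "p \<in> set (labels t)"
  shows "mset (labels (graft p m t)) = add_mset m (mset (labels t))"
  using assms by (simp add: mset_labels_graft distinct_count_atmost_1)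

text \<open>One multiset equation captures both distinctness and the label set, and a graft changes
  it by a single \<open>add_mset\<close>.\<close>

lemma increasing_trees_mset:
  "t \<in> increasing_trees n \<longleftrightarrow> mset (labels t) = mset_set {0..n} \<and> increasing t"
proof -
  have "mset (labels t) = mset_set {0..n}" if "distinct (labels t)" "set (labels t) = {0..n}"
    using mset_set_set[OF that(1)] that(2) by simp
  moreover have "set (labels t) = {0..n}" "distinct (labels t)"
    if m: "mset (labels t) = mset_set {0..n}"
  proof -
    have "mset (labels t) = mset [0..<Suc n]"
      using m by (simp only: mset_upt atLeastLessThanSuc_atLeastAtMost)
    then show "distinct (labels t)" using mset_eq_imp_distinct_iff distinct_upt by blast
    show "set (labels t) = {0..n}" using arg_cong[OF m, of set_mset] by simp
  qed
  ultimately show ?thesis unfolding increasing_trees_iff by blast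
qed

text \<open>Injective because \<open>prune\<close> recovers the tree and \<open>parents\<close> the
  node; surjective by \<open>increasing_eq_graft\<close>, as the root has label 0 and not
  \<open>Suc n\<close>.\<close>

lemma bij_betw_graft:
  "bij_betw (\<lambda>(t, p). graft p (Suc n) t) (increasing_trees n \<times> {0..n}) (increasing_trees (Suc n))"
proof (rule bij_betw_imageI)
  have new: "Suc n \<notin> set (labels t)" if "t \<in> increasing_trees n" for t
    using that by (simp add: increasing_trees_iff)
  have "t = s \<and> p = q"
    if "t \<in> increasing_trees n" "s \<in> increasing_trees n" "p \<in> {0..n}" "q \<in> {0..n}"
      "graft p (Suc n) t = graft q (Suc n) s" for t s p q
  proof -
    have "t = s" using that new prune_graft by metis
    moreover have "{p} = {q}"
      using parents_graft[OF new, of t p] parents_graft[OF new, of s q] that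
      by (auto simp: increasing_trees_iff)
    ultimately show ?thesis by simp
  qed
  then show "inj_on (\<lambda>(t, p). graft p (Suc n) t) (increasing_trees n \<times> {0..n})"
    by (auto simp: inj_on_def)
  have mset_Suc: "mset_set {0..Suc n} = add_mset (Suc n) (mset_set {0..n})"
    by (simp add: atLeast0_atMost_Suc)
  show "(\<lambda>(t, p). graft p (Suc n) t) ` (increasing_trees n \<times> {0..n}) = increasing_trees (Suc n)"
  proof (intro equalityI subsetI)
    fix t assume "t \<in> (\<lambda>(t, p). graft p (Suc n) t) ` (increasing_trees n \<times> {0..n})"
    then obtain s p where s: "t = graft p (Suc n) s" "s \<in> increasing_trees n" "p \<in> {0..n}"
      by auto
    then have "mset (labels t) = mset_set {0..Suc n}"
      unfolding mset_Suc by (metis increasing_trees_iff increasing_trees_mset mset_labels_graft_distinct)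
    moreover have "increasing t"
      using s by (auto simp: increasing_trees_iff intro!: increasing_graft)
    ultimately show "t \<in> increasing_trees (Suc n)" by (simp add: increasing_trees_mset)
  next
    fix t assume t: "t \<in> increasing_trees (Suc n)"
    then obtain p s where s: "t = graft p (Suc n) s" "p \<in> set (labels s)"
        "Suc n \<notin> set (labels s)" "increasing s"
      using increasing_eq_graft[of t "Suc n"] label_increasing_trees[OF t]
      by (auto simp: increasing_trees_iff)
    \<comment> \<open>Up to order, the labels of \<open>t\<close> extend those of \<open>s\<close>,
      so \<open>s\<close> inherits distinctness.\<close>
    have "mset (labels t) =
        mset (labels s @ replicate (count (mset (labels s)) p) (Suc n))"
      by (simp add: s(1) mset_labels_graft)
    then have "distinct (labels s @ replicate (count (mset (labels s)) p) (Suc n))"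
      using t mset_eq_imp_distinct_iff unfolding increasing_trees_iff by blast
    then have "distinct (labels s)" by simp
    then have "add_mset (Suc n) (mset (labels s)) = mset_set {0..Suc n}"
      using t s(1,2) mset_labels_graft_distinct by (metis increasing_trees_mset)
    then have "s \<in> increasing_trees n"
      using s(4) by (simp add: increasing_trees_mset mset_Suc)
    moreover from this have "p \<in> {0..n}" using s(2) by (simp add: increasing_trees_iff)
    ultimately show "t \<in> (\<lambda>(t, p). graft p (Suc n) t) ` (increasing_trees n \<times> {0..n})"
      using s(1) by force
  qed
qed


section \<open>Weights\<close>

text \<open>Any four elements of a commutative ring will do, which keeps the polynomial
  representation out of the computation.\<close>

locale tree_weights =
  fixes w x y z :: "'a::comm_ring_1"
begin

definition node_weight :: "nat \<Rightarrow> nat \<Rightarrow> 'a" where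
  "node_weight k d = (if k = 0 then w else if odd d then z else if odd k then y else x)"

fun weight :: "nat \<Rightarrow> ptree \<Rightarrow> 'a" where
  "weight k (Node a ts) = node_weight k (length ts) * prod_list (map (weight (Suc k)) ts)"

text \<open>Links the recursive weight to the flat node list on which the statistics are
  counted.\<close>

lemma weight_eq_prod_nodes_from:
  "weight k t = prod_list (map (\<lambda>(j, s). node_weight j (degree s)) (nodes_from k t))"
proof (induction t arbitrary: k)
  case (Node a ts)
  then have "map (weight (Suc k)) ts =
      map (\<lambda>t. prod_list (map (\<lambda>(j, s). node_weight j (degree s)) (nodes_from (Suc k) t))) ts"
    by (intro map_cong[OF refl])
  moreover have "prod_list (map f (concat xss)) = prod_list (map (\<lambda>xs. prod_list (map f xs)) xss)"
    for f :: "nat \<times> ptree \<Rightarrow> 'a" and xss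
    by (induction xss) auto
  ultimately show ?case by (simp add: degree_def comp_def del: map_eq_conv)
qed

lemma prod_node_weight_nonroot:
  assumes "\<forall>(k, s)\<in>set ns. k \<noteq> 0"
  shows "prod_list (map (\<lambda>(k, s). node_weight k (degree s)) ns) =
    x ^ length (filter (\<lambda>(k, s). k \<noteq> 0 \<and> even k \<and> even (degree s)) ns) *
    y ^ length (filter (\<lambda>(k, s). k \<noteq> 0 \<and> odd k \<and> even (degree s)) ns) *
    z ^ length (filter (\<lambda>(k, s). k \<noteq> 0 \<and> odd (degree s)) ns)"
  using assms by (induction ns) (auto simp: node_weight_def)

lemma weight_0: "weight 0 t = w * (x ^ ee_star t * y ^ oe_star t * z ^ odd_star t)"
proof (cases t)
  case (Node a ts)
  have "\<forall>(k, s)\<in>set (concat (map (nodes_from (Suc 0)) ts)). k \<noteq> 0"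
    using level_nodes_from by fastforce
  from prod_node_weight_nonroot[OF this] show ?thesis
    by (simp add: weight_eq_prod_nodes_from Node ee_star_def oe_star_def odd_star_def
        node_weight_def)
qed

end

section \<open>The derivation acting on weights\<close>

locale tree_derivation = tree_weights w x y z for w x y z :: "'a::comm_ring_1" +
  fixes D :: "'a \<Rightarrow> 'a"
  assumes deriv: "derivation D"
    and Dw: "D w = w * y" and Dx: "D x = y * z" and Dy: "D y = x * z" and Dz: "D z = x * y"
begin

lemma D_add: "D (u + v) = D u + D v" and D_mult: "D (u * v) = D u * v + u * D v"
  using deriv by (auto simp: derivation_def)

lemma D_0: "D 0 = 0" and D_1: "D 1 = 0"
  using D_add[of 0 0] D_mult[of 1 1] by simp_all

lemma D_sum: "D (sum f A) = (\<Sum>a\<in>A. D (f a))"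
  by (induction A rule: infinite_finite_induct) (simp_all add: D_0 D_add)

text \<open>This is where the four rules for \<open>D\<close> enter: the parent gains one child, and
  the second factor is the weight of the new leaf one level below.\<close>

lemma D_node_weight: "D (node_weight k d) = node_weight k (Suc d) * node_weight (Suc k) 0"
  by (simp add: node_weight_def Dw Dx Dy Dz mult.commute)

text \<open>Leibniz rule for a forest: differentiating one factor attaches the leaf within that
  tree, and disjointness of the labels leaves the other trees fixed.\<close>

lemma D_prod_grafts:
  assumes "\<And>t. t \<in> set ts \<Longrightarrow> D (f t) = (\<Sum>p\<in>set (labels t). f (graft p m t))"
    and "distinct (concat (map labels ts))"
  shows "D (prod_list (map f ts)) =
    (\<Sum>p\<in>set (concat (map labels ts)). prod_list (map f (map (graft p m) ts)))"
  using assms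
proof (induction ts)
  case Nil
  then show ?case by (simp add: D_1)
next
  case (Cons t ts)
  let ?A = "set (labels t)" and ?B = "set (concat (map labels ts))"
  have disj: "?A \<inter> ?B = {}" using Cons.prems(2) by auto
  have "D (prod_list (map f (t # ts))) =
      (\<Sum>p\<in>?A. f (graft p m t)) * prod_list (map f ts) +
      f t * (\<Sum>p\<in>?B. prod_list (map f (map (graft p m) ts)))"
    using Cons by (simp add: D_mult)
  also have "(\<Sum>p\<in>?A. f (graft p m t)) * prod_list (map f ts) =
      (\<Sum>p\<in>?A. prod_list (map f (map (graft p m) (t # ts))))"
    unfolding sum_distrib_right
  proof (rule sum.cong)
    fix p assume "p \<in> ?A"
    then have "map (graft p m) ts = ts" using disj by (intro map_graft_eq_self) blast
    then show "f (graft p m t) * prod_list (map f ts) =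
        prod_list (map f (map (graft p m) (t # ts)))" by simp
  qed simp
  also have "f t * (\<Sum>p\<in>?B. prod_list (map f (map (graft p m) ts))) =
      (\<Sum>p\<in>?B. prod_list (map f (map (graft p m) (t # ts))))"
    unfolding sum_distrib_left
  proof (rule sum.cong)
    fix p assume "p \<in> ?B"
    then have "graft p m t = t" using disj by (intro graft_eq_self) blast
    then show "f t * prod_list (map f (map (graft p m) ts)) =
        prod_list (map f (map (graft p m) (t # ts)))" by simp
  qed simp
  also have "(\<Sum>p\<in>?A. prod_list (map f (map (graft p m) (t # ts)))) +
      (\<Sum>p\<in>?B. prod_list (map f (map (graft p m) (t # ts)))) =
      (\<Sum>p\<in>?A \<union> ?B. prod_list (map f (map (graft p m) (t # ts))))"
    by (rule sum.union_disjoint[symmetric]) (use disj in simp_all)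
  finally show ?case by simp
qed

text \<open>Distinct labels let \<open>p\<close> stand for a node. Weights ignore labels, so
  \<open>m\<close> is arbitrary.\<close>

lemma D_weight:
  assumes "distinct (labels t)"
  shows "D (weight k t) = (\<Sum>p\<in>set (labels t). weight k (graft p m t))"
  using assms
proof (induction t arbitrary: k)
  case (Node a ts)
  let ?L = "set (concat (map labels ts))" and ?u = "node_weight k (length ts)"
  have a: "a \<notin> ?L" and dist: "distinct (concat (map labels ts))" using Node.prems by auto
  have IH: "D (weight (Suc k) t) = (\<Sum>p\<in>set (labels t). weight (Suc k) (graft p m t))"
    if "t \<in> set ts" for t
    using Node.IH[OF that] dist that by (simp add: distinct_concat_iff)
  \<comment> \<open>A leaf at the root raises its degree and adds a factor for level
    \<open>Suc k\<close>; together these make up \<open>D ?u\<close>.\<close>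
  have at_a: "weight k (graft a m (Node a ts)) = D ?u * prod_list (map (weight (Suc k)) ts)"
    using map_graft_eq_self[OF a, of m] by (simp add: D_node_weight mult_ac)
  have below: "weight k (graft p m (Node a ts)) =
      ?u * prod_list (map (weight (Suc k)) (map (graft p m) ts))" if "p \<in> ?L" for p
    using a that by auto
  have "D (weight k (Node a ts)) = D ?u * prod_list (map (weight (Suc k)) ts) +
      ?u * (\<Sum>p\<in>?L. prod_list (map (weight (Suc k)) (map (graft p m) ts)))"
    by (simp only: weight.simps D_mult D_prod_grafts[OF IH dist])
  also have "\<dots> = weight k (graft a m (Node a ts)) + (\<Sum>p\<in>?L. weight k (graft p m (Node a ts)))"
    by (simp only: at_a below sum_distrib_left cong: sum.cong)
  also have "\<dots> = (\<Sum>p\<in>insert a ?L. weight k (graft p m (Node a ts)))"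
    by (rule sum.insert[symmetric]) (use a in simp_all)
  finally show ?case by simp
qed

lemma funpow_D_root: "(D ^^ n) w = (\<Sum>t\<in>increasing_trees n. weight 0 t)"
proof (induction n)
  case 0
  then show ?case by (simp add: increasing_trees_0 node_weight_def)
next
  case (Suc n)
  have "(D ^^ Suc n) w = (\<Sum>t\<in>increasing_trees n. D (weight 0 t))"
    by (simp add: Suc D_sum)
  \<comment> \<open>The free leaf label of \<open>D_weight\<close> is set to \<open>Suc n\<close> to
    match \<open>bij_betw_graft\<close>.\<close>
  also have "\<dots> = (\<Sum>t\<in>increasing_trees n. \<Sum>p\<in>{0..n}. weight 0 (graft p (Suc n) t))"
    by (intro sum.cong refl) (simp add: D_weight[where m = "Suc n"] increasing_trees_iff)
  also have "\<dots> = (\<Sum>(t, p)\<in>increasing_trees n \<times> {0..n}. weight 0 (graft p (Suc n) t))"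
    by (rule sum.cartesian_product)
  also have "\<dots> = (\<Sum>t\<in>increasing_trees (Suc n). weight 0 t)"
    using sum.reindex_bij_betw[OF bij_betw_graft, of "weight 0" n]
    by (simp add: case_prod_unfold)
  finally show ?case .
qed

end

theorem theorem3p3:
  fixes D :: "zpoly \<Rightarrow> zpoly" and n :: nat
  assumes "derivation D"
    and "D (var W) = var W * var Y"
    and "D (var X) = var Y * var Z"
    and "D (var Y) = var X * var Z"
    and "D (var Z) = var X * var Y"
  shows "(D ^^ n) (var W) =
    var W * (\<Sum>T\<in>increasing_trees n.
      var X ^ ee_star T * var Y ^ oe_star T * var Z ^ odd_star T)"
proof -
  interpret tree_derivation "var W" "var X" "var Y" "var Z" D
    using assms by unfold_locales
  show ?thesis by (simp add: funpow_D_root weight_0 sum_distrib_left)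
qed

end
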